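(* Let $P_{YZ}$ be a joint probability distribution of random variables $Y,Z$ with finite alphabets. For every $\varepsilon\in[0,1)$, $$K_\varepsilon(Y|Z)_P\;\le\;\min_{\eta\in(0,1-\varepsilon]}\frac1\eta\,\beta_{\varepsilon+\eta}(P_{YZ},\mathbb 1_Y\times P_Z),$$ and for every $\varepsilon\in(0,1)$, $$K_\varepsilon(Y|Z)_P\;\ge\;\max_{\eta\in[0,\varepsilon)}\Big\lfloor\frac{4\eta^2}{\varepsilon-\eta}\,\max_{Q_Z}\beta_{\varepsilon-\eta}(P_{YZ},\mathbb 1_Y\times Q_Z)\Big\rfloor,$$ where the inner maximum is over all probability distributions $Q_Z$ on the alphabet of $Z$.
   Context: All alphabets are finite, and probability mass functions are regarded as real vectors; $|Y|$ denotes the alphabet size of $Y$. $\mathbb 1$ is the all-ones vector, $R_V$ is the uniform distribution on the alphabet of $V$, $\times$ is the product (tensor product of vectors), so $(\mathbb 1_Y\times Q_Z)(y,z)=Q_Z(z)$. $P_Z$ is the marginal of $P_{YZ}$. For a probability vector $P$, a nonnegative vector $Q$ (not necessarily normalized) and $\alpha\in[0,1]$, $$\beta_\alpha(P,Q):=\min_\Lambda\{\langle\Lambda,Q\rangle:\langle\Lambda,P\rangle\ge\alpha,\ 0\le\Lambda\le\mathbb 1\},$$ with $\langle\cdot,\cdot\rangle$ the Euclidean inner product and inequalities entrywise. The variational distance is $\delta(P,Q)=\max_{0\le\Lambda\le\mathbb 1}\langle\Lambda,P-Q\rangle=\tfrac12\|P-Q\|_1$ for probability vectors. A protocol for $(k,\varepsilon)$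 privacy amplification of $Y$ relative to $Z$ is a function $f$ from the alphabet of $Y$ to a finite alphabet of size $|V|$ with $\log|V|=k$ ($f$ need not be surjective) such that, with $V=f(Y)$ and $P_{VZ}$ the induced joint distribution, $\delta(P_{VZ},R_V\times P_Z)\le\varepsilon$. $K_\varepsilon(Y|Z)_P$ is the largest $K\in\mathbb N$ for which a $(\log K,\varepsilon)$ privacy amplification protocol for $P_{YZ}$ exists. *)

theory Defs
  imports "HOL-Probability.Probability"
begin

text \<open>
  Real vectors indexed by a finite alphabet \<open>A\<close> are functions of which only the values on \<open>A\<close>
  matter.  Minima and maxima are written with \<open>LEAST\<close> and \<open>GREATEST\<close>, that is, as least and
  greatest elements and not merely as infima and suprema.
\<close>

definition inner_on :: "'a set \<Rightarrow> ('a \<Rightarrow> real) \<Rightarrow> ('a \<Rightarrow> real) \<Rightarrow> real" where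
  "inner_on A u v = (\<Sum>x\<in>A. u x * v x)"

definition tensor :: "('a \<Rightarrow> real) \<Rightarrow> ('b \<Rightarrow> real) \<Rightarrow> 'a \<times> 'b \<Rightarrow> real" where
  "tensor u v = (\<lambda>(x, y). u x * v y)"

definition ones :: "'a \<Rightarrow> real" where
  "ones = (\<lambda>_. 1)"

definition tests :: "'a set \<Rightarrow> ('a \<Rightarrow> real) set" where
  "tests A = {\<Lambda>. \<forall>x\<in>A. 0 \<le> \<Lambda> x \<and> \<Lambda> x \<le> 1}"

definition beta_min :: "'a set \<Rightarrow> real \<Rightarrow> ('a \<Rightarrow> real) \<Rightarrow> ('a \<Rightarrow> real) \<Rightarrow> real" where
  "beta_min A \<alpha> P Q =
     (LEAST b. \<exists>\<Lambda>\<in>tests A. inner_on A \<Lambda> P \<ge> \<alpha> \<and> b = inner_on A \<Lambda> Q)"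

definition var_dist :: "'a set \<Rightarrow> ('a \<Rightarrow> real) \<Rightarrow> ('a \<Rightarrow> real) \<Rightarrow> real" where
  "var_dist A P Q =
     (GREATEST d. \<exists>\<Lambda>\<in>tests A. d = inner_on A \<Lambda> (\<lambda>x. P x - Q x))"

text \<open>
  The key alphabet of size \<open>K\<close> is \<open>{..<K}\<close>.  Since \<open>'y\<close> is nonempty, the condition on \<open>f\<close>
  forces \<open>K > 0\<close>, so \<open>pmf_of_set\<close> is applied to a nonempty finite set.  The parameter \<open>K\<close>
  stands for \<open>k = log K\<close>.
\<close>

definition privacy_amplification ::
    "('y::finite \<times> 'z::finite) pmf \<Rightarrow> nat \<Rightarrow> real \<Rightarrow> ('y \<Rightarrow> nat) \<Rightarrow> bool" where
  "privacy_amplification P K \<epsilon> f \<longleftrightarrow>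
     f \<in> UNIV \<rightarrow> {..<K} \<and>
     var_dist ({..<K} \<times> UNIV)
       (pmf (map_pmf (\<lambda>(y, z). (f y, z)) P))
       (tensor (pmf (pmf_of_set {..<K})) (pmf (map_pmf snd P))) \<le> \<epsilon>"

definition max_key_size :: "real \<Rightarrow> ('y::finite \<times> 'z::finite) pmf \<Rightarrow> nat" where
  "max_key_size \<epsilon> P = (GREATEST K. \<exists>f. privacy_amplification P K \<epsilon> f)"

end

theory Submission
  imports Defs
begin

text \<open>
  Converse: a test \<open>\<Lambda>\<close> for \<open>P\<close> against \<open>1 \<times> P\<^sub>Z\<close> is pushed forward along \<open>f\<close> to
  \<open>\<Lambda>' (v, z) = min 1 (\<Sum>\<^bsub>f y = v\<^esub> \<Lambda> (y, z))\<close>; it still accepts \<open>P\<^sub>V\<^sub>Z\<close> with probability at least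
  \<open>\<epsilon> + \<eta>\<close>, hence accepts \<open>R\<^sub>V \<times> P\<^sub>Z\<close> with probability at least \<open>\<eta>\<close>, and the latter
  probability is at most \<open>1 / K\<close> times the value of \<open>\<Lambda>\<close>.

  Achievability: put \<open>\<alpha> = \<epsilon> - \<eta>\<close>, let \<open>\<beta>\<close> be the optimal value and truncate \<open>P\<close> to
  \<open>P' = min P ((\<alpha> / \<beta>) (1 \<times> Q))\<close>. Optimality of \<open>\<beta>\<close> bounds the removed mass by \<open>\<alpha>\<close>, while
  \<open>P'\<close> has min-entropy at least \<open>log (\<beta> / \<alpha>)\<close> relative to \<open>Q\<close>, so that leftover hashing into
  \<open>K \<le> 4 \<eta>\<^sup>2 \<beta> / \<alpha>\<close> values costs at most \<open>\<eta>\<close> more.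
\<close>

section \<open>Extrema over the unit cube\<close>

text \<open>Heine-Borel in \<open>real^'a\<close>: the admissible set is closed inside
  \<open>cbox 0 1\<close>, hence compact. Stated for plain functions, it yields optimal tests, an
  optimal \<eta> and an optimal \<open>Q\<close>.\<close>

lemma cube_attains_inf:
  fixes g :: "('a::finite \<Rightarrow> real) \<Rightarrow> real"
  assumes cont: "continuous_on {v. C (vec_nth v)} (\<lambda>v. g (vec_nth v))"
    and closed: "closed {v. C (vec_nth v)}"
    and cube: "\<And>u x. C u \<Longrightarrow> 0 \<le> u x \<and> u x \<le> 1"
    and ne: "C u0"
  shows "\<exists>u. C u \<and> (\<forall>u'. C u' \<longrightarrow> g u \<le> g u')"
proof -
  let ?S = "{v. C (vec_nth v)}"
  have "?S \<subseteq> cbox 0 1"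
    using cube by (auto simp: mem_box_cart)
  then have "compact ?S"
    using closed by (metis bounded_cbox bounded_subset compact_eq_bounded_closed)
  moreover have "?S \<noteq> {}"
    using ne by (auto intro!: exI[of _ "vec_lambda u0"] simp: vec_lambda_inverse)
  ultimately obtain v where v: "v \<in> ?S" "\<And>v'. v' \<in> ?S \<Longrightarrow> g (vec_nth v) \<le> g (vec_nth v')"
    using continuous_attains_inf[OF _ _ cont] by blast
  have "g (vec_nth v) \<le> g u'" if "C u'" for u'
    using v(2)[of "vec_lambda u'"] that by (simp add: vec_lambda_inverse)
  then show ?thesis using v(1) by auto
qed

lemma continuous_on_inner_on [continuous_intros]:
  "continuous_on S (\<lambda>v. inner_on A (vec_nth v) Q)"
  "continuous_on S (\<lambda>v. inner_on A Q (vec_nth v))"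
  unfolding inner_on_def by (intro continuous_intros)+

lemma closed_tests: "closed {v :: real^'a. vec_nth v \<in> tests UNIV \<and> a \<le> inner_on UNIV (vec_nth v) P}"
proof -
  have "{v :: real^'a. vec_nth v \<in> tests UNIV \<and> a \<le> inner_on UNIV (vec_nth v) P}
      = cbox 0 1 \<inter> {v. a \<le> inner_on UNIV (vec_nth v) P}"
    by (auto simp: tests_def mem_box_cart)
  also have "closed \<dots>"
    by (intro closed_Int closed_cbox closed_Collect_le continuous_intros)
  finally show ?thesis .
qed

section \<open>The functional beta and the variational distance\<close>

lemma inner_on_ones: "inner_on UNIV ones (pmf P) = 1" for P :: "'a::finite pmf"
  using sum_pmf_eq_1[of UNIV P] by (simp add: inner_on_def ones_def)

lemma ones_in_tests [simp]: "ones \<in> tests A"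
  by (simp add: tests_def ones_def)

lemma inner_on_scale: "inner_on A (\<lambda>x. c * u x) Q = c * inner_on A u Q"
  by (simp add: inner_on_def sum_distrib_left mult.assoc)

lemma inner_on_mono:
  "(\<And>x. x \<in> A \<Longrightarrow> u x * Q x \<le> u' x * Q' x) \<Longrightarrow> inner_on A u Q \<le> inner_on A u' Q'"
  unfolding inner_on_def by (rule sum_mono)

lemma inner_on_nonneg:
  "u \<in> tests A \<Longrightarrow> (\<And>x. x \<in> A \<Longrightarrow> 0 \<le> Q x) \<Longrightarrow> 0 \<le> inner_on A u Q"
  unfolding inner_on_def tests_def by (auto intro: sum_nonneg)

text \<open>\<open>LEAST\<close> carries information only when the minimum is attained. Compactness
  gives this; \<alpha> \<le> 1 makes \<open>ones\<close> feasible.\<close>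

lemma beta_min_attained:
  fixes P :: "'a::finite pmf"
  assumes "\<alpha> \<le> 1"
  obtains \<Lambda> where "\<Lambda> \<in> tests UNIV" "\<alpha> \<le> inner_on UNIV \<Lambda> (pmf P)"
    "beta_min UNIV \<alpha> (pmf P) Q = inner_on UNIV \<Lambda> Q"
    "\<And>\<Lambda>'. \<Lambda>' \<in> tests UNIV \<Longrightarrow> \<alpha> \<le> inner_on UNIV \<Lambda>' (pmf P) \<Longrightarrow>
       beta_min UNIV \<alpha> (pmf P) Q \<le> inner_on UNIV \<Lambda>' Q"
proof -
  have "\<exists>u. (u \<in> tests UNIV \<and> \<alpha> \<le> inner_on UNIV u (pmf P)) \<and>
      (\<forall>u'. u' \<in> tests UNIV \<and> \<alpha> \<le> inner_on UNIV u' (pmf P) \<longrightarrow>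
         inner_on UNIV u Q \<le> inner_on UNIV u' Q)"
    using assms
    by (intro cube_attains_inf[where ?u0.0 = ones] closed_tests continuous_intros)
      (simp_all add: inner_on_ones, auto simp: tests_def)
  then obtain u where u: "u \<in> tests UNIV" "\<alpha> \<le> inner_on UNIV u (pmf P)"
    "\<And>u'. u' \<in> tests UNIV \<Longrightarrow> \<alpha> \<le> inner_on UNIV u' (pmf P) \<Longrightarrow>
       inner_on UNIV u Q \<le> inner_on UNIV u' Q"
    by blast
  then have "beta_min UNIV \<alpha> (pmf P) Q = inner_on UNIV u Q"
    unfolding beta_min_def by (intro Least_equality) auto
  with u show thesis using that by simp
qed

lemma beta_min_le:
  fixes P :: "'a::finite pmf"
  assumes "\<Lambda> \<in> tests UNIV" "\<alpha> \<le> inner_on UNIV \<Lambda> (pmf P)" "\<alpha> \<le> 1"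
  shows "beta_min UNIV \<alpha> (pmf P) Q \<le> inner_on UNIV \<Lambda> Q"
  by (rule beta_min_attained[OF assms(3), of P Q]) (use assms(1,2) in blast)

text \<open>The indicator of \<open>Q x \<le> P x\<close> keeps exactly the nonnegative terms of P -
  Q, hence is an optimal test. So the \<open>GREATEST\<close> exists, and later arguments need only
  bound each test.\<close>

lemma var_dist_le_iff:
  fixes A :: "'a set"
  assumes "finite A"
  shows "var_dist A P Q \<le> e \<longleftrightarrow> (\<forall>\<Lambda>\<in>tests A. inner_on A \<Lambda> (\<lambda>x. P x - Q x) \<le> e)"
proof -
  define u :: "'a \<Rightarrow> real" where "u x = of_bool (Q x \<le> P x)" for x
  have u: "u \<in> tests A" by (auto simp: u_def tests_def)
  have le: "inner_on A \<Lambda> (\<lambda>x. P x - Q x) \<le> inner_on A u (\<lambda>x. P x - Q x)" if "\<Lambda> \<in> tests A" for \<Lambda>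
    using that by (intro inner_on_mono)
      (auto simp: u_def tests_def mult_left_le_one_le mult_nonneg_nonpos)
  have "var_dist A P Q = inner_on A u (\<lambda>x. P x - Q x)"
    unfolding var_dist_def using u le by (intro Greatest_equality) auto
  then show ?thesis using u le by (auto intro: order_trans)
qed

section \<open>Pushforwards and the security condition as finite sums\<close>

lemma pmf_map_eq_sum:
  fixes P :: "'a::finite pmf"
  shows "pmf (map_pmf g P) x = (\<Sum>a\<in>UNIV. of_bool (g a = x) * pmf P a)"
proof -
  have "pmf (map_pmf g P) x = (\<Sum>a\<in>g -` {x}. pmf P a)"
    by (simp add: pmf_map measure_measure_pmf_finite)
  also have "\<dots> = (\<Sum>a\<in>UNIV. of_bool (g a = x) * pmf P a)"
    by (intro sum.mono_neutral_cong_left) auto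
  finally show ?thesis .
qed

text \<open>Brings a sum over key values to the innermost place, where
  \<open>of_bool (f y = v)\<close> collapses it.\<close>

lemma sum_rotate:
  fixes h :: "'u \<Rightarrow> 'v \<Rightarrow> 'w \<Rightarrow> real"
  shows "(\<Sum>u\<in>A. \<Sum>v\<in>B. \<Sum>w\<in>C. h u v w) = (\<Sum>w\<in>C. \<Sum>v\<in>B. \<Sum>u\<in>A. h u v w)"
proof -
  have "(\<Sum>u\<in>A. \<Sum>v\<in>B. \<Sum>w\<in>C. h u v w) = (\<Sum>u\<in>A. \<Sum>w\<in>C. \<Sum>v\<in>B. h u v w)"
    by (intro sum.cong refl sum.swap)
  also have "\<dots> = (\<Sum>w\<in>C. \<Sum>u\<in>A. \<Sum>v\<in>B. h u v w)" by (rule sum.swap)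
  also have "\<dots> = (\<Sum>w\<in>C. \<Sum>v\<in>B. \<Sum>u\<in>A. h u v w)"
    by (intro sum.cong refl sum.swap)
  finally show ?thesis .
qed

lemma sum_UNIV_prod: "(\<Sum>x\<in>UNIV. h x) = (\<Sum>y\<in>UNIV. \<Sum>z\<in>UNIV. h (y, z))"
  for h :: "'y::finite \<times> 'z::finite \<Rightarrow> real"
  by (simp add: sum.cartesian_product)

lemma pmf_snd: "pmf (map_pmf snd P) z = (\<Sum>y\<in>UNIV. pmf P (y, z))"
  for P :: "('y::finite \<times> 'z::finite) pmf"
  by (simp add: pmf_map_eq_sum sum_UNIV_prod)

lemma pmf_apfst:
  "pmf (map_pmf (\<lambda>(y, z). (f y, z)) P) (v, z) = (\<Sum>y\<in>UNIV. of_bool (f y = v) * pmf P (y, z))"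
  for P :: "('y::finite \<times> 'z::finite) pmf"
  unfolding pmf_map_eq_sum sum_UNIV_prod
proof (rule sum.cong)
  fix y
  show "(\<Sum>z'\<in>UNIV. of_bool ((case (y, z') of (y, z) \<Rightarrow> (f y, z)) = (v, z)) * pmf P (y, z'))
      = of_bool (f y = v) * pmf P (y, z)"
    by (cases "f y = v") simp_all
qed simp

text \<open>In this form the condition is linear in P, so that P can later be split into a truncated
  part and a remainder. The factor \<open>of_bool (f y = v) - 1 / K\<close> is the deviation of a
  deterministic key from uniform.\<close>

lemma privacy_amplification_iff:
  fixes P :: "('y::finite \<times> 'z::finite) pmf"
  shows "privacy_amplification P K \<epsilon> f \<longleftrightarrow> (\<forall>y. f y < K) \<and>
    (\<forall>\<Lambda>\<in>tests ({..<K} \<times> UNIV). (\<Sum>v<K. \<Sum>z\<in>UNIV. \<Lambda> (v, z) *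
        (\<Sum>y\<in>UNIV. (of_bool (f y = v) - 1 / K) * pmf P (y, z))) \<le> \<epsilon>)"
proof (cases "\<forall>y. f y < K")
  case True
  then have "0 < K" by (metis gr0I not_less0)
  have "inner_on ({..<K} \<times> UNIV) \<Lambda> (\<lambda>x. pmf (map_pmf (\<lambda>(y, z). (f y, z)) P) x -
       tensor (pmf (pmf_of_set {..<K})) (pmf (map_pmf snd P)) x)
     = (\<Sum>v<K. \<Sum>z\<in>UNIV. \<Lambda> (v, z) *
        (\<Sum>y\<in>UNIV. (of_bool (f y = v) - 1 / K) * pmf P (y, z)))" for \<Lambda>
    unfolding inner_on_def sum.cartesian_product'
    using \<open>0 < K\<close> by (intro sum.cong)
      (simp_all add: tensor_def pmf_apfst pmf_snd lessThan_empty_iff sum_subtractf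
        left_diff_distrib sum_divide_distrib)
  then show ?thesis
    using True by (auto simp: privacy_amplification_def var_dist_le_iff)
qed (auto simp: privacy_amplification_def)

section \<open>Converse\<close>

text \<open>The test need not be optimal: an optimal one gives the converse, while
  \<open>ones\<close> gives finiteness of the largest key size.\<close>

lemma privacy_amplification_bound:
  fixes P :: "('y::finite \<times> 'z::finite) pmf"
  assumes pa: "privacy_amplification P K \<epsilon> f"
    and L: "\<Lambda> \<in> tests UNIV" "\<epsilon> + \<eta> \<le> inner_on UNIV \<Lambda> (pmf P)"
  shows "\<eta> * K \<le> inner_on UNIV \<Lambda> (tensor ones (pmf (map_pmf snd P)))"
proof -
  let ?PZ = "pmf (map_pmf snd P)"
  have f: "f y < K" for y using pa by (simp add: privacy_amplification_iff)
  then have K: "0 < K" by (metis gr0I not_less0)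
  define S where "S v z = (\<Sum>y\<in>UNIV. of_bool (f y = v) * \<Lambda> (y, z))" for v z
  define M where "M = (\<lambda>(v, z). min 1 (S v z))"
  have L0: "0 \<le> \<Lambda> x" "\<Lambda> x \<le> 1" for x using L(1) unfolding tests_def by blast+
  have "0 \<le> S v z" for v z unfolding S_def using L0 by (intro sum_nonneg) auto
  then have M: "M \<in> tests ({..<K} \<times> UNIV)" by (auto simp: tests_def M_def)
  \<comment> \<open>\<open>\<Lambda> (y, z)\<close> is one of the nonnegative summands of
    \<open>S (f y) z\<close> and at most 1, so it survives the cap in \<open>M\<close>.\<close>
  have "\<Lambda> (y, z) \<le> S (f y) z" for y z
  proof -
    have "of_bool (f y = f y) * \<Lambda> (y, z) \<le> S (f y) z"
      unfolding S_def using L0 by (intro member_le_sum) auto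
    then show ?thesis by simp
  qed
  then have M_ge: "\<Lambda> (y, z) \<le> M (f y, z)" for y z using L0 by (simp add: M_def)
  \<comment> \<open>The two halves of the deviation give the acceptance probabilities of
    \<open>M\<close> under P_VZ and under the uniform key times P_Z.\<close>
  have "(\<Sum>v<K. \<Sum>z\<in>UNIV. M (v, z) * (\<Sum>y\<in>UNIV. (of_bool (f y = v) - 1 / K) * pmf P (y, z)))
     = (\<Sum>v<K. \<Sum>z\<in>UNIV. \<Sum>y\<in>UNIV. of_bool (f y = v) * (M (v, z) * pmf P (y, z)))
      - (\<Sum>v<K. \<Sum>z\<in>UNIV. M (v, z) * ?PZ z) / K"
    unfolding pmf_snd sum_distrib_left sum_divide_distrib sum_subtractf[symmetric]
    by (intro sum.cong refl) (simp add: algebra_simps)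
  also have "(\<Sum>v<K. \<Sum>z\<in>UNIV. \<Sum>y\<in>UNIV. of_bool (f y = v) * (M (v, z) * pmf P (y, z)))
     = (\<Sum>y\<in>UNIV. \<Sum>z\<in>UNIV. \<Sum>v<K. of_bool (f y = v) * (M (v, z) * pmf P (y, z)))"
    by (rule sum_rotate)
  also have "\<dots> = (\<Sum>y\<in>UNIV. \<Sum>z\<in>UNIV. M (f y, z) * pmf P (y, z))"
    using f by simp
  finally have eq: "(\<Sum>v<K. \<Sum>z\<in>UNIV. M (v, z) *
      (\<Sum>y\<in>UNIV. (of_bool (f y = v) - 1 / K) * pmf P (y, z)))
     = (\<Sum>y\<in>UNIV. \<Sum>z\<in>UNIV. M (f y, z) * pmf P (y, z))
      - (\<Sum>v<K. \<Sum>z\<in>UNIV. M (v, z) * ?PZ z) / K" .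
  have "(\<Sum>y\<in>UNIV. \<Sum>z\<in>UNIV. M (f y, z) * pmf P (y, z))
      - (\<Sum>v<K. \<Sum>z\<in>UNIV. M (v, z) * ?PZ z) / K \<le> \<epsilon>"
    unfolding eq[symmetric] using pa M unfolding privacy_amplification_iff by blast
  moreover have "inner_on UNIV \<Lambda> (pmf P) \<le> (\<Sum>y\<in>UNIV. \<Sum>z\<in>UNIV. M (f y, z) * pmf P (y, z))"
    unfolding inner_on_def sum_UNIV_prod using M_ge by (intro sum_mono mult_right_mono) auto
  ultimately have "\<eta> \<le> (\<Sum>v<K. \<Sum>z\<in>UNIV. M (v, z) * ?PZ z) / K"
    using L(2) by linarith
  then have "\<eta> * K \<le> (\<Sum>v<K. \<Sum>z\<in>UNIV. M (v, z) * ?PZ z)"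
    using K by (simp add: pos_le_divide_eq)
  \<comment> \<open>The cap is dropped; each y lies in exactly one bin, so summing \<open>S\<close>
    over the bins restores the value of \<open>\<Lambda>\<close>.\<close>
  also have "\<dots> \<le> (\<Sum>v<K. \<Sum>z\<in>UNIV. S v z * ?PZ z)"
    by (intro sum_mono mult_right_mono) (auto simp: M_def)
  also have "\<dots> = (\<Sum>v<K. \<Sum>z\<in>UNIV. \<Sum>y\<in>UNIV. of_bool (f y = v) * (\<Lambda> (y, z) * ?PZ z))"
    by (simp add: S_def sum_distrib_right mult.assoc)
  also have "\<dots> = (\<Sum>y\<in>UNIV. \<Sum>z\<in>UNIV. \<Sum>v<K. of_bool (f y = v) * (\<Lambda> (y, z) * ?PZ z))"
    by (rule sum_rotate)
  also have "\<dots> = inner_on UNIV \<Lambda> (tensor ones ?PZ)"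
    using f by (simp add: inner_on_def sum_UNIV_prod tensor_def ones_def)
  finally show ?thesis .
qed

section \<open>Existence of a largest key size\<close>

lemma privacy_amplification_trivial:
  assumes "0 \<le> \<epsilon>" shows "privacy_amplification P 1 \<epsilon> (\<lambda>_. 0)"
  using assms by (simp add: privacy_amplification_iff)

text \<open>\<open>ones\<close> accepts P with certainty, so \<eta> = 1 - \<epsilon> is allowed. The
  resulting bound depends on neither K nor f, as \<open>GREATEST\<close> over the naturals
  requires.\<close>

lemma privacy_amplification_le_card:
  fixes P :: "('y::finite \<times> 'z::finite) pmf"
  assumes "\<epsilon> < 1" "privacy_amplification P K \<epsilon> f"
  shows "K \<le> nat \<lfloor>inner_on UNIV (ones :: 'y \<times> 'z \<Rightarrow> real) (tensor ones (pmf (map_pmf snd P))) / (1 - \<epsilon>)\<rfloor>"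
proof -
  have "(1 - \<epsilon>) * K \<le> inner_on UNIV (ones :: 'y \<times> 'z \<Rightarrow> real) (tensor ones (pmf (map_pmf snd P)))"
    using privacy_amplification_bound[OF assms(2), of ones "1 - \<epsilon>"] by (simp add: inner_on_ones)
  then have "real K \<le> inner_on UNIV (ones :: 'y \<times> 'z \<Rightarrow> real) (tensor ones (pmf (map_pmf snd P))) / (1 - \<epsilon>)"
    using assms by (simp add: field_simps)
  then show ?thesis by (simp add: le_nat_floor)
qed

lemma max_key_size_attained:
  fixes P :: "('y::finite \<times> 'z::finite) pmf"
  assumes "0 \<le> \<epsilon>" "\<epsilon> < 1"
  shows "\<exists>f. privacy_amplification P (max_key_size \<epsilon> P) \<epsilon> f"
  unfolding max_key_size_def
proof (rule GreatestI_nat[where P = "\<lambda>K. \<exists>f. privacy_amplification P K \<epsilon> f"])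
  show "\<exists>f. privacy_amplification P 1 \<epsilon> f"
    using privacy_amplification_trivial[OF assms(1)] by blast
qed (erule exE, erule privacy_amplification_le_card[OF assms(2)])

lemma le_max_key_size:
  fixes P :: "('y::finite \<times> 'z::finite) pmf"
  assumes "\<epsilon> < 1" "privacy_amplification P K \<epsilon> f"
  shows "K \<le> max_key_size \<epsilon> P"
  unfolding max_key_size_def
proof (rule Greatest_le_nat[where P = "\<lambda>K. \<exists>f. privacy_amplification P K \<epsilon> f"])
  show "\<exists>f. privacy_amplification P K \<epsilon> f" using assms(2) by blast
qed (erule exE, erule privacy_amplification_le_card[OF assms(1)])

section \<open>Attainment of the minimum over \<eta>\<close>

text \<open>
  For \<open>\<epsilon> = 0\<close> the ratio equals the least likelihood ratio \<open>Q x / P x\<close> for all small \<open>\<eta>\<close>; for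
  \<open>\<epsilon> > 0\<close> it blows up as \<open>\<eta>\<close> tends to \<open>0\<close>, so that a compactness argument applies.
\<close>
lemma beta_ratio_attains_min:
  fixes P :: "'a::finite pmf"
  assumes Q: "\<And>x. 0 \<le> Q x" "\<And>x. 0 < pmf P x \<Longrightarrow> 0 < Q x"
    and \<epsilon>: "0 \<le> \<epsilon>" "\<epsilon> < 1"
  shows "\<exists>\<eta>\<in>{0<..1-\<epsilon>}. \<forall>\<eta>'\<in>{0<..1-\<epsilon>}.
    1 / \<eta> * beta_min UNIV (\<epsilon> + \<eta>) (pmf P) Q \<le> 1 / \<eta>' * beta_min UNIV (\<epsilon> + \<eta>') (pmf P) Q"
proof -
  let ?\<beta> = "\<lambda>\<eta>. beta_min UNIV (\<epsilon> + \<eta>) (pmf P) Q"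
  let ?R = "(\<lambda>x. Q x / pmf P x) ` set_pmf P"
  have "Min ?R \<in> ?R" by (intro Min_in) (auto simp: set_pmf_not_empty)
  then obtain x where "x \<in> set_pmf P" "Min ?R = Q x / pmf P x" by blast
  moreover have "Min ?R \<le> Q x' / pmf P x'" if "x' \<in> set_pmf P" for x'
    using that by (intro Min_le) auto
  ultimately have x: "x \<in> set_pmf P" "\<And>x'. x' \<in> set_pmf P \<Longrightarrow> Q x / pmf P x \<le> Q x' / pmf P x'"
    by auto
  \<comment> \<open>As the least likelihood ratio on the support of P, c satisfies c * P \<le> Q
    everywhere; a test thus costs at least c times its acceptance probability.\<close>
  define c where "c = Q x / pmf P x"
  have Px: "0 < pmf P x" using x by (simp add: pmf_positive)
  then have c: "0 < c" using Q by (simp add: c_def)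
  have "c * pmf P x' \<le> Q x'" for x'
    using x(2)[of x'] Q(1)[of x'] pmf_positive[of x' P]
    by (cases "x' \<in> set_pmf P") (auto simp: c_def set_pmf_iff pos_le_divide_eq)
  then have lin: "c * inner_on UNIV u (pmf P) \<le> inner_on UNIV u Q" if "u \<in> tests UNIV" for u
    unfolding inner_on_def sum_distrib_left using that
    by (intro sum_mono) (simp add: tests_def mult.left_commute[of c] mult_left_mono)
  have \<beta>_ge: "c * (\<epsilon> + \<eta>) \<le> ?\<beta> \<eta>" if "\<epsilon> + \<eta> \<le> 1" for \<eta>
  proof -
    obtain u where u: "u \<in> tests UNIV" "\<epsilon> + \<eta> \<le> inner_on UNIV u (pmf P)" "?\<beta> \<eta> = inner_on UNIV u Q"
      using beta_min_attained[OF \<open>\<epsilon> + \<eta> \<le> 1\<close>] by metis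
    have "c * (\<epsilon> + \<eta>) \<le> c * inner_on UNIV u (pmf P)" using u c by simp
    with lin[OF u(1)] u(3) show ?thesis by linarith
  qed
  show ?thesis
  proof (cases "\<epsilon> = 0")
    case True
    \<comment> \<open>The indicator of the minimising point attains the lower bound c, at \<eta> =
      \<open>pmf P x\<close>.\<close>
    define u where "u = (\<lambda>y. of_bool (x = y) :: real)"
    have u: "u \<in> tests UNIV" "inner_on UNIV u (pmf P) = pmf P x" "inner_on UNIV u Q = Q x"
      by (auto simp: u_def tests_def inner_on_def)
    have "?\<beta> (pmf P x) \<le> Q x"
      using beta_min_le[of u "\<epsilon> + pmf P x" P Q] u True by (simp add: pmf_le_1)
    then have "1 / pmf P x * ?\<beta> (pmf P x) \<le> c"
      using Px by (simp add: c_def divide_right_mono)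
    moreover have "c \<le> 1 / \<eta>' * ?\<beta> \<eta>'" if "\<eta>' \<in> {0<..1-\<epsilon>}" for \<eta>'
      using \<beta>_ge[of \<eta>'] that True by (simp add: field_simps)
    ultimately show ?thesis using Px True
      by (intro bexI[of _ "pmf P x"] ballI) (auto simp: pmf_le_1 intro: order_trans)
  next
    case False
    define B where "B = inner_on UNIV ones Q"
    have B: "?\<beta> (1 - \<epsilon>) \<le> B"
      unfolding B_def by (intro beta_min_le) (auto simp: inner_on_ones)
    have "0 < c * (\<epsilon> + (1 - \<epsilon>))" using c by simp
    then have "0 < B" using \<beta>_ge[of "1 - \<epsilon>"] B by linarith
    \<comment> \<open>For \<eta>' below this threshold the lower bound c * \<epsilon> / \<eta>' on
      the ratio is at least B / (1 - \<epsilon>), an upper bound for the ratio at 1 - \<epsilon>; so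
      small \<eta>' never beat that endpoint.\<close>
    define \<eta>0 where "\<eta>0 = min (1 - \<epsilon>) (c * \<epsilon> * (1 - \<epsilon>) / B)"
    have \<eta>0: "0 < \<eta>0" "\<eta>0 \<le> 1 - \<epsilon>"
      using \<epsilon> False c \<open>0 < B\<close> by (auto simp: \<eta>0_def)
    \<comment> \<open>Minimising over tests avoids any regularity of beta in its level: a test with
      acceptance s admits \<eta> up to s - \<epsilon>, and s \<ge> \<epsilon> +
      \<open>\<eta>0\<close> keeps the denominator away from zero.\<close>
    define g where "g u = inner_on UNIV u Q / (inner_on UNIV u (pmf P) - \<epsilon>)" for u
    have "\<exists>u. (u \<in> tests UNIV \<and> \<epsilon> + \<eta>0 \<le> inner_on UNIV u (pmf P)) \<and>
      (\<forall>u'. u' \<in> tests UNIV \<and> \<epsilon> + \<eta>0 \<le> inner_on UNIV u' (pmf P) \<longrightarrow> g u \<le> g u')"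
      unfolding g_def using \<eta>0
      by (intro cube_attains_inf[where ?u0.0 = ones] closed_tests continuous_intros)
        (simp_all add: inner_on_ones, auto simp: tests_def)
    then obtain u where u: "u \<in> tests UNIV" "\<epsilon> + \<eta>0 \<le> inner_on UNIV u (pmf P)"
      "\<And>u'. u' \<in> tests UNIV \<Longrightarrow> \<epsilon> + \<eta>0 \<le> inner_on UNIV u' (pmf P) \<Longrightarrow> g u \<le> g u'"
      by blast
    define \<eta> where "\<eta> = inner_on UNIV u (pmf P) - \<epsilon>"
    have "inner_on UNIV u (pmf P) \<le> inner_on UNIV ones (pmf P)"
      using u by (intro inner_on_mono) (auto simp: tests_def ones_def mult_left_le_one_le)
    then have \<eta>: "\<eta>0 \<le> \<eta>" "\<eta> \<le> 1 - \<epsilon>" using u by (auto simp: \<eta>_def inner_on_ones)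
    have "?\<beta> \<eta> \<le> inner_on UNIV u Q"
      using u \<eta> by (intro beta_min_le) (auto simp: \<eta>_def)
    then have gu: "1 / \<eta> * ?\<beta> \<eta> \<le> g u"
      using \<eta> \<eta>0 by (simp add: g_def \<eta>_def divide_right_mono)
    have large: "g u \<le> 1 / \<eta>' * ?\<beta> \<eta>'" if \<eta>': "\<eta>0 \<le> \<eta>'" "\<eta>' \<le> 1 - \<epsilon>" for \<eta>'
    proof -
      obtain w where w: "w \<in> tests UNIV" "\<epsilon> + \<eta>' \<le> inner_on UNIV w (pmf P)"
          "?\<beta> \<eta>' = inner_on UNIV w Q"
        using beta_min_attained[of "\<epsilon> + \<eta>'" P Q] \<eta>' by (metis add.commute le_diff_eq)
      have "g u \<le> g w" using u(3)[of w] w \<eta>' by simp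
      also have "g w \<le> inner_on UNIV w Q / \<eta>'"
        unfolding g_def using w \<eta>' \<eta>0 Q by (intro divide_left_mono inner_on_nonneg mult_pos_pos) auto
      finally show ?thesis using w by simp
    qed
    have small: "1 / (1 - \<epsilon>) * ?\<beta> (1 - \<epsilon>) \<le> 1 / \<eta>' * ?\<beta> \<eta>'" if \<eta>': "0 < \<eta>'" "\<eta>' \<le> \<eta>0" for \<eta>'
    proof -
      have "\<eta>' * B \<le> c * \<epsilon> * (1 - \<epsilon>)"
        using \<eta>' \<open>0 < B\<close> by (simp add: \<eta>0_def pos_le_divide_eq)
      then have "B / (1 - \<epsilon>) \<le> c * \<epsilon> / \<eta>'" using \<eta>' \<epsilon> by (simp add: field_simps)
      moreover have "?\<beta> (1 - \<epsilon>) / (1 - \<epsilon>) \<le> B / (1 - \<epsilon>)"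
        using B \<epsilon> by (intro divide_right_mono) auto
      moreover have "c * \<epsilon> \<le> c * (\<epsilon> + \<eta>')" using c \<eta>' by simp
      then have "c * \<epsilon> \<le> ?\<beta> \<eta>'"
        using \<beta>_ge[of \<eta>'] \<eta>' \<eta>0 by linarith
      then have "c * \<epsilon> / \<eta>' \<le> ?\<beta> \<eta>' / \<eta>'" using \<eta>' by (intro divide_right_mono) auto
      ultimately show ?thesis by simp
    qed
    have "g u \<le> 1 / \<eta>' * ?\<beta> \<eta>'" if "\<eta>' \<in> {0<..1-\<epsilon>}" for \<eta>'
      using that large[of \<eta>'] large[of "1 - \<epsilon>"] small[of \<eta>'] \<eta>0
      by (cases "\<eta>0 \<le> \<eta>'") auto
    with gu \<eta> \<eta>0 show ?thesis by (intro bexI[of _ \<eta>] ballI) (auto intro: order_trans)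
  qed
qed

section \<open>Achievability\<close>

text \<open>
  Derandomised leftover hashing: the points are assigned one at a time, each to a bin whose
  current discrepancy has nonpositive inner product with it; such a bin exists because the
  discrepancies sum to zero.
\<close>
lemma balanced_colouring:
  fixes p :: "'y \<Rightarrow> 'z \<Rightarrow> real"
  assumes "finite A" "0 < K" and w: "\<And>z. z \<in> B \<Longrightarrow> 0 \<le> w z"
  shows "\<exists>f. (\<forall>y. f y < K) \<and>
    (\<Sum>v<K. \<Sum>z\<in>B. w z * (\<Sum>y\<in>A. (of_bool (f y = v) - 1 / real K) * p y z)\<^sup>2)
      \<le> (\<Sum>y\<in>A. \<Sum>z\<in>B. w z * (p y z)\<^sup>2)"
  using \<open>finite A\<close>
proof induction
  case empty
  then show ?case using \<open>0 < K\<close> by auto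
next
  case (insert x A)
  then obtain f where f: "\<And>y. f y < K"
    "(\<Sum>v<K. \<Sum>z\<in>B. w z * (\<Sum>y\<in>A. (of_bool (f y = v) - 1 / real K) * p y z)\<^sup>2)
      \<le> (\<Sum>y\<in>A. \<Sum>z\<in>B. w z * (p y z)\<^sup>2)"
    by blast
  define d where "d v z = (\<Sum>y\<in>A. (of_bool (f y = v) - 1 / real K) * p y z)" for v z
  define e where "e v = (\<Sum>z\<in>B. w z * (d v z * p x z))" for v
  define N where "N = (\<Sum>z\<in>B. w z * (p x z)\<^sup>2)"
  have bias: "(\<Sum>v<K. of_bool (u = v) - 1 / real K) = 0" if "u < K" for u
    using that \<open>0 < K\<close> by (simp add: sum_subtractf)
  have d0: "(\<Sum>v<K. d v z) = 0" for z
    unfolding d_def by (subst sum.swap) (simp add: sum_distrib_right[symmetric] bias f)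
  have e0: "(\<Sum>v<K. e v) = 0"
    unfolding e_def
    by (subst sum.swap) (simp add: sum_distrib_left[symmetric] sum_distrib_right[symmetric] d0)
  have "\<not> (\<forall>v<K. 0 < e v)"
  proof
    assume "\<forall>v<K. 0 < e v"
    then have "0 < (\<Sum>v<K. e v)"
      using \<open>0 < K\<close> by (intro sum_pos) (auto simp: lessThan_empty_iff)
    with e0 show False by simp
  qed
  then obtain v0 where v0: "v0 < K" "e v0 \<le> 0" by (auto simp: not_less)
  define b where "b v = of_bool (v0 = v) - 1 / real K" for v
  let ?f = "f(x := v0)"
  have step: "(\<Sum>y\<in>insert x A. (of_bool (?f y = v) - 1 / real K) * p y z) = d v z + b v * p x z" for v z
  proof -
    have "(\<Sum>y\<in>A. (of_bool (?f y = v) - 1 / real K) * p y z) = d v z"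
      unfolding d_def using insert by (intro sum.cong) auto
    then show ?thesis using insert by (simp add: b_def)
  qed
  have "(\<Sum>v<K. \<Sum>z\<in>B. w z * (d v z + b v * p x z)\<^sup>2)
      = (\<Sum>v<K. \<Sum>z\<in>B. w z * (d v z)\<^sup>2) + (\<Sum>v<K. 2 * b v * e v) + (\<Sum>v<K. (b v)\<^sup>2 * N)"
    unfolding e_def N_def sum_distrib_left sum.distrib[symmetric]
    by (intro sum.cong) (auto simp: power2_eq_square algebra_simps)
  \<comment> \<open>The uniform part of \<open>b\<close> drops out because \<open>e\<close> sums to
    zero; what remains is nonpositive by the choice of \<open>v0\<close>.\<close>
  also have "(\<Sum>v<K. 2 * b v * e v) = 2 * e v0"
  proof -
    have "2 * b v * e v = 2 * (of_bool (v0 = v) * e v) - 2 / K * e v" for v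
      by (simp add: b_def algebra_simps)
    then have "(\<Sum>v<K. 2 * b v * e v) = 2 * (\<Sum>v<K. of_bool (v0 = v) * e v) - 2 / K * (\<Sum>v<K. e v)"
      by (simp only: sum_subtractf sum_distrib_left)
    then show ?thesis using v0 e0 by simp
  qed
  also have "(\<Sum>v<K. (b v)\<^sup>2 * N) = (1 - 1 / K) * N"
  proof -
    have "(b v)\<^sup>2 = (1 - 1 / K) * of_bool (v0 = v) - 1 / K * b v" for v
      by (simp add: b_def power2_eq_square algebra_simps)
    then have "(\<Sum>v<K. (b v)\<^sup>2) = (1 - 1 / K) * (\<Sum>v<K. of_bool (v0 = v)) - 1 / K * (\<Sum>v<K. b v)"
      by (simp only: sum_subtractf sum_distrib_left)
    also have "\<dots> = 1 - 1 / K" using v0 bias[of v0] by (simp add: b_def)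
    finally show ?thesis by (simp add: sum_distrib_right[symmetric])
  qed
  also have "(\<Sum>v<K. \<Sum>z\<in>B. w z * (d v z)\<^sup>2) + 2 * e v0 + (1 - 1 / K) * N
      \<le> (\<Sum>y\<in>A. \<Sum>z\<in>B. w z * (p y z)\<^sup>2) + N"
  proof -
    have "0 \<le> N" unfolding N_def using w by (intro sum_nonneg) auto
    then have "(1 - 1 / K) * N \<le> N" by (simp add: algebra_simps)
    with f(2) v0 show ?thesis by (simp add: d_def)
  qed
  finally show ?case
    using insert f v0 by (intro exI[of _ ?f]) (simp add: step N_def add.commute del: fun_upd_apply, simp)
qed

text \<open>Optimality of beta applied to the rescaled likelihood ratio test.\<close>
lemma smoothing_loss_le:
  fixes P :: "'a::finite pmf"
  assumes "0 < \<alpha>" "\<alpha> \<le> 1" and Q: "\<And>x. 0 \<le> Q x"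
    and \<beta>: "0 < \<beta>" "\<beta> \<le> beta_min UNIV \<alpha> (pmf P) Q"
  shows "(\<Sum>x\<in>UNIV. pmf P x - min (pmf P x) (\<alpha> / \<beta> * Q x)) \<le> \<alpha>"
proof -
  \<comment> \<open>\<open>u\<close> selects the points where truncation bites, ties included; only
    these contribute to the loss.\<close>
  define u where "u x = (of_bool (\<alpha> / \<beta> * Q x \<le> pmf P x) :: real)" for x
  define s where "s = inner_on UNIV u (pmf P)"
  have eq: "(\<Sum>x\<in>UNIV. pmf P x - min (pmf P x) (\<alpha> / \<beta> * Q x)) = s - \<alpha> / \<beta> * inner_on UNIV u Q"
    unfolding s_def inner_on_def sum_distrib_left sum_subtractf[symmetric]
    by (intro sum.cong) (auto simp: u_def)
  show ?thesis
  proof (cases "s \<le> \<alpha>")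
    case True
    have "0 \<le> inner_on UNIV u Q" using Q by (intro inner_on_nonneg) (auto simp: tests_def u_def)
    then have "0 \<le> \<alpha> / \<beta> * inner_on UNIV u Q" using assms by simp
    with True eq show ?thesis by linarith
  next
    case False
    \<comment> \<open>Since s > \<alpha>, scaling by \<alpha> / s gives a valid test with acceptance
      exactly \<alpha>; optimality then makes the loss at most zero in this case.\<close>
    define t where "t = \<alpha> / s"
    have t: "0 \<le> t" "t \<le> 1" "t * s = \<alpha>" using False assms by (auto simp: t_def)
    have "beta_min UNIV \<alpha> (pmf P) Q \<le> inner_on UNIV (\<lambda>x. t * u x) Q"
      using t assms by (intro beta_min_le) (auto simp: inner_on_scale s_def[symmetric], auto simp: tests_def u_def)
    then have "\<beta> \<le> \<alpha> / s * inner_on UNIV u Q"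
      using \<beta> unfolding inner_on_scale t_def by linarith
    then have "s \<le> \<alpha> / \<beta> * inner_on UNIV u Q" using False assms by (simp add: field_simps)
    then show ?thesis using eq assms by linarith
  qed
qed

text \<open>Cauchy-Schwarz for sqrt q and |d| / sqrt q. Where q is zero, \<open>d\<close> vanishes
  and division by zero yields zero, so such indices contribute nothing to either side.\<close>

lemma sum_abs_le_weighted:
  fixes d q :: "'i \<Rightarrow> real"
  assumes "finite I" "\<And>i. i \<in> I \<Longrightarrow> 0 \<le> q i" "\<And>i. i \<in> I \<Longrightarrow> q i = 0 \<Longrightarrow> d i = 0"
  shows "(\<Sum>i\<in>I. \<bar>d i\<bar>)\<^sup>2 \<le> (\<Sum>i\<in>I. q i) * (\<Sum>i\<in>I. 1 / q i * (d i)\<^sup>2)"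
proof -
  have "(\<Sum>i\<in>I. \<bar>d i\<bar>) = (\<Sum>i\<in>I. sqrt (q i) * (\<bar>d i\<bar> / sqrt (q i)))"
    using assms by (intro sum.cong) auto
  then have "(\<Sum>i\<in>I. \<bar>d i\<bar>)\<^sup>2 \<le> (\<Sum>i\<in>I. (sqrt (q i))\<^sup>2) * (\<Sum>i\<in>I. (\<bar>d i\<bar> / sqrt (q i))\<^sup>2)"
    using Cauchy_Schwarz_ineq_sum[of "\<lambda>i. sqrt (q i)" "\<lambda>i. \<bar>d i\<bar> / sqrt (q i)" I] by simp
  also have "\<dots> = (\<Sum>i\<in>I. q i) * (\<Sum>i\<in>I. 1 / q i * (d i)\<^sup>2)"
    using assms by (intro arg_cong2[of _ _ _ _ "(*)"] sum.cong) (auto simp: power_divide)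
  finally show ?thesis .
qed

lemma privacy_amplification_exists:
  fixes P :: "('y::finite \<times> 'z::finite) pmf" and Q :: "'z pmf"
  assumes \<alpha>: "0 < \<alpha>" "\<alpha> \<le> 1" and "0 \<le> \<eta>" and K: "0 < K"
    and le: "K \<le> 4 * \<eta>\<^sup>2 / \<alpha> * beta_min UNIV \<alpha> (pmf P) (tensor ones (pmf Q))"
  shows "\<exists>f. privacy_amplification P K (\<alpha> + \<eta>) f"
proof -
  define \<beta> where "\<beta> = beta_min UNIV \<alpha> (pmf P) (tensor ones (pmf Q))"
  have "0 < 4 * \<eta>\<^sup>2 / \<alpha> * \<beta>" using le K unfolding \<beta>_def by linarith
  then have \<beta>: "0 < \<beta>" using \<alpha> by (simp add: zero_less_mult_iff zero_less_divide_iff)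
  \<comment> \<open>The factor 4 is the square of 2: variational distance is half an L1 norm, so the
    L1 norm may reach 2 * \<eta>.\<close>
  have K\<beta>: "K * (\<alpha> / \<beta>) \<le> (2 * \<eta>)\<^sup>2"
    using le \<alpha> \<beta> unfolding \<beta>_def[symmetric] by (simp add: field_simps power2_eq_square)
  define p where "p y z = min (pmf P (y, z)) (\<alpha> / \<beta> * pmf Q z)" for y z
  have p: "0 \<le> p y z" "p y z \<le> pmf P (y, z)" "p y z \<le> \<alpha> / \<beta> * pmf Q z" for y z
    using \<alpha> \<beta> by (auto simp: p_def)
  define r where "r y z = pmf P (y, z) - p y z" for y z
  have "0 \<le> (tensor ones (pmf Q) :: 'y \<times> 'z \<Rightarrow> real) x" for x
    by (cases x) (simp add: tensor_def ones_def)
  then have loss: "(\<Sum>y\<in>UNIV. \<Sum>z\<in>UNIV. r y z) \<le> \<alpha>"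
    using smoothing_loss_le[of \<alpha> "tensor ones (pmf Q)" \<beta> P] \<alpha> \<beta>
    by (simp add: sum_UNIV_prod r_def p_def tensor_def ones_def \<beta>_def)
  \<comment> \<open>The weight \<open>1 / pmf Q z\<close> is zero where Q vanishes, but there p
    vanishes too, so nothing is lost.\<close>
  obtain f where f: "\<And>y. f y < K" and var:
    "(\<Sum>v<K. \<Sum>z\<in>UNIV. 1 / pmf Q z * (\<Sum>y\<in>UNIV. (of_bool (f y = v) - 1 / real K) * p y z)\<^sup>2)
      \<le> (\<Sum>y\<in>UNIV. \<Sum>z\<in>UNIV. 1 / pmf Q z * (p y z)\<^sup>2)"
    using balanced_colouring[of UNIV K UNIV "\<lambda>z. 1 / pmf Q z" p] K by auto
  define d where "d = (\<lambda>(v, z). \<Sum>y\<in>UNIV. (of_bool (f y = v) - 1 / real K) * p y z)"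
  let ?I = "{..<K} \<times> (UNIV :: 'z set)"
  have bias: "(\<Sum>v<K. of_bool (f y = v) - 1 / real K) = 0" for y
    using f[of y] K by (simp add: sum_subtractf)
  have d0: "(\<Sum>i\<in>?I. d i) = 0"
  proof -
    have "(\<Sum>v<K. d (v, z)) = 0" for z
      unfolding d_def prod.case
      by (subst sum.swap) (simp add: sum_distrib_right[symmetric] bias)
    then show ?thesis
      unfolding sum.cartesian_product[symmetric, of "\<lambda>v z. d (v, z)", simplified]
      by (subst sum.swap) simp
  qed
  have pz: "p y z = 0" if "pmf Q z = 0" for y z
    using p(1,3)[of y z] that by simp
  have "(\<Sum>i\<in>?I. \<bar>d i\<bar>)\<^sup>2 \<le> (\<Sum>i\<in>?I. pmf Q (snd i)) * (\<Sum>i\<in>?I. 1 / pmf Q (snd i) * (d i)\<^sup>2)"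
    by (intro sum_abs_le_weighted) (auto simp: d_def pz)
  also have "(\<Sum>i\<in>?I. pmf Q (snd i)) = K"
    by (simp add: sum.cartesian_product' sum_pmf_eq_1)
  also have "(\<Sum>i\<in>?I. 1 / pmf Q (snd i) * (d i)\<^sup>2) \<le> \<alpha> / \<beta>"
  proof -
    have "(\<Sum>i\<in>?I. 1 / pmf Q (snd i) * (d i)\<^sup>2) \<le> (\<Sum>y\<in>UNIV. \<Sum>z\<in>UNIV. 1 / pmf Q z * (p y z)\<^sup>2)"
      using var by (simp add: sum.cartesian_product' d_def)
    also have "\<dots> \<le> (\<Sum>y\<in>UNIV. \<Sum>z\<in>UNIV. \<alpha> / \<beta> * pmf P (y, z))"
    proof (intro sum_mono)
      fix y z
      \<comment> \<open>One factor is bounded by the truncation level, the other by P; after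
        division by \<open>pmf Q z\<close> the sum is at most \<alpha> / \<beta>.\<close>
      have "p y z * p y z \<le> (\<alpha> / \<beta> * pmf Q z) * pmf P (y, z)"
        using p \<alpha> \<beta> by (intro mult_mono) auto
      then show "1 / pmf Q z * (p y z)\<^sup>2 \<le> \<alpha> / \<beta> * pmf P (y, z)"
        using \<alpha> \<beta> by (cases "pmf Q z = 0") (auto simp: power2_eq_square pmf_pos field_simps)
    qed
    also have "\<dots> = \<alpha> / \<beta>"
      using sum_pmf_eq_1[of UNIV P] unfolding sum_UNIV_prod sum_distrib_left[symmetric] by simp
    finally show ?thesis .
  qed
  finally have "(\<Sum>i\<in>?I. \<bar>d i\<bar>)\<^sup>2 \<le> (2 * \<eta>)\<^sup>2"
    using K\<beta> by (simp add: mult_left_mono)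
  then have dl: "(\<Sum>i\<in>?I. \<bar>d i\<bar>) \<le> 2 * \<eta>"
    by (rule power2_le_imp_le) (use \<open>0 \<le> \<eta>\<close> in simp)
  have "(\<Sum>v<K. \<Sum>z\<in>UNIV. \<Lambda> (v, z) *
        (\<Sum>y\<in>UNIV. (of_bool (f y = v) - 1 / K) * pmf P (y, z))) \<le> \<alpha> + \<eta>"
    if L: "\<Lambda> \<in> tests ?I" for \<Lambda>
  proof -
    have "(\<Sum>v<K. \<Sum>z\<in>UNIV. \<Lambda> (v, z) * (\<Sum>y\<in>UNIV. (of_bool (f y = v) - 1 / K) * pmf P (y, z)))
      = (\<Sum>i\<in>?I. \<Lambda> i * d i) +
        (\<Sum>v<K. \<Sum>z\<in>UNIV. \<Lambda> (v, z) * (\<Sum>y\<in>UNIV. (of_bool (f y = v) - 1 / K) * r y z))"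
      by (simp add: sum.cartesian_product' d_def r_def right_diff_distrib sum_subtractf)
    \<comment> \<open>A test extracts at most the positive part of \<open>d\<close>, which is half
      the L1 norm because \<open>d\<close> sums to zero.\<close>
    also have "(\<Sum>i\<in>?I. \<Lambda> i * d i) \<le> (\<Sum>i\<in>?I. d i / 2 + \<bar>d i\<bar> / 2)"
    proof (intro sum_mono)
      fix i assume "i \<in> ?I"
      then have "0 \<le> \<Lambda> i" "\<Lambda> i \<le> 1" using L by (auto simp: tests_def)
      then show "\<Lambda> i * d i \<le> d i / 2 + \<bar>d i\<bar> / 2"
        by (cases "0 \<le> d i") (auto simp: mult_left_le_one_le mult_nonneg_nonpos)
    qed
    also have "\<dots> \<le> \<eta>"
      using d0 dl by (simp add: sum.distrib sum_divide_distrib[symmetric])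
    \<comment> \<open>For the removed mass the subtracted uniform term is discarded, leaving at most
      the total of \<open>r\<close>.\<close>
    also have "(\<Sum>v<K. \<Sum>z\<in>UNIV. \<Lambda> (v, z) * (\<Sum>y\<in>UNIV. (of_bool (f y = v) - 1 / K) * r y z))
      \<le> (\<Sum>v<K. \<Sum>z\<in>UNIV. \<Sum>y\<in>UNIV. of_bool (f y = v) * r y z)"
    proof (intro sum_mono)
      fix v z assume "v \<in> {..<K}"
      then have l: "0 \<le> \<Lambda> (v, z)" "\<Lambda> (v, z) \<le> 1" using L by (auto simp: tests_def)
      have r: "0 \<le> r y z" for y using p by (simp add: r_def)
      have "(\<Sum>y\<in>UNIV. (of_bool (f y = v) - 1 / K) * r y z) \<le> (\<Sum>y\<in>UNIV. of_bool (f y = v) * r y z)"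
        using r by (intro sum_mono mult_right_mono) auto
      then have "\<Lambda> (v, z) * (\<Sum>y\<in>UNIV. (of_bool (f y = v) - 1 / K) * r y z)
         \<le> \<Lambda> (v, z) * (\<Sum>y\<in>UNIV. of_bool (f y = v) * r y z)"
        using l by (intro mult_left_mono)
      also have "\<dots> \<le> (\<Sum>y\<in>UNIV. of_bool (f y = v) * r y z)"
        using l r by (intro mult_left_le_one_le sum_nonneg) auto
      finally show "\<Lambda> (v, z) * (\<Sum>y\<in>UNIV. (of_bool (f y = v) - 1 / K) * r y z)
         \<le> (\<Sum>y\<in>UNIV. of_bool (f y = v) * r y z)" .
    qed
    also have "(\<Sum>v<K. \<Sum>z\<in>UNIV. \<Sum>y\<in>UNIV. of_bool (f y = v) * r y z)
      = (\<Sum>y\<in>UNIV. \<Sum>z\<in>UNIV. \<Sum>v<K. of_bool (f y = v) * r y z)"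
      by (rule sum_rotate)
    also have "\<dots> = (\<Sum>y\<in>UNIV. \<Sum>z\<in>UNIV. r y z)" using f by simp
    also have "\<dots> \<le> \<alpha>" by (rule loss)
    finally show ?thesis by simp
  qed
  then show ?thesis using f by (auto simp: privacy_amplification_iff)
qed

section \<open>Attainment of the maxima over Q and over \<eta>\<close>

text \<open>Feasibility involves only P, so a test optimal for q' also serves q; as its values are
  at most 1, the change costs at most the L1 distance once per letter of Y. This gives continuity in
  q.\<close>

lemma beta_min_Lipschitz:
  fixes P :: "('y::finite \<times> 'z::finite) pmf" and q q' :: "'z \<Rightarrow> real"
  assumes "\<alpha> \<le> 1"
  shows "beta_min UNIV \<alpha> (pmf P) (tensor ones q) \<le> beta_min UNIV \<alpha> (pmf P) (tensor ones q')
    + real CARD('y) * (\<Sum>z\<in>UNIV. \<bar>q z - q' z\<bar>)"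
proof -
  obtain u where u: "u \<in> tests UNIV" "\<alpha> \<le> inner_on UNIV u (pmf P)"
    "beta_min UNIV \<alpha> (pmf P) (tensor ones q') = inner_on UNIV u (tensor ones q')"
    using beta_min_attained[OF assms] by metis
  have "beta_min UNIV \<alpha> (pmf P) (tensor ones q) \<le> inner_on UNIV u (tensor ones q)"
    using u assms by (intro beta_min_le)
  also have "\<dots> \<le> inner_on UNIV u (tensor ones q') + (\<Sum>y\<in>(UNIV::'y set). \<Sum>z\<in>UNIV. \<bar>q z - q' z\<bar>)"
    unfolding inner_on_def sum_UNIV_prod sum.distrib[symmetric]
  proof (intro sum_mono)
    fix y z
    have "0 \<le> u (y, z)" "u (y, z) \<le> 1" using u by (auto simp: tests_def)
    then have "u (y, z) * (q z - q' z) \<le> \<bar>q z - q' z\<bar>"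
      by (cases "0 \<le> q z - q' z") (auto simp: mult_left_le_one_le intro: order_trans[OF mult_nonneg_nonpos])
    then show "u (y, z) * tensor ones q (y, z) \<le> u (y, z) * tensor ones q' (y, z) + \<bar>q z - q' z\<bar>"
      by (simp add: tensor_def ones_def algebra_simps)
  qed
  finally show ?thesis using u by simp
qed

lemma beta_min_attains_max:
  fixes P :: "('y::finite \<times> 'z::finite) pmf"
  assumes "\<alpha> \<le> 1"
  shows "\<exists>Q :: 'z pmf. \<forall>Q' :: 'z pmf. beta_min UNIV \<alpha> (pmf P) (tensor ones (pmf Q'))
    \<le> beta_min UNIV \<alpha> (pmf P) (tensor ones (pmf Q))"
proof -
  let ?g = "\<lambda>q :: 'z \<Rightarrow> real. beta_min UNIV \<alpha> (pmf P) (tensor ones q)"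
  let ?C = "\<lambda>q :: 'z \<Rightarrow> real. q \<in> tests UNIV \<and> inner_on UNIV ones q = 1"
  have C: "?C (pmf Q)" for Q :: "'z pmf" by (auto simp: inner_on_ones tests_def pmf_le_1)
  have "continuous_on S (\<lambda>v :: real^'z. ?g (vec_nth v))" for S
  proof (unfold continuous_on_def, intro ballI)
    fix v assume "v \<in> S"
    have "((\<lambda>w. real CARD('y) * (\<Sum>z\<in>UNIV. \<bar>w $ z - v $ z\<bar>)) \<longlongrightarrow>
       real CARD('y) * (\<Sum>z\<in>UNIV. \<bar>v $ z - v $ z\<bar>)) (at v within S)"
      by (intro tendsto_intros)
    then have lim: "((\<lambda>w. real CARD('y) * (\<Sum>z\<in>UNIV. \<bar>w $ z - v $ z\<bar>)) \<longlongrightarrow> 0) (at v within S)"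
      by simp
    have "\<bar>?g (vec_nth w) - ?g (vec_nth v)\<bar> \<le> real CARD('y) * (\<Sum>z\<in>UNIV. \<bar>w $ z - v $ z\<bar>)" for w
      using beta_min_Lipschitz[OF assms, of P "vec_nth w" "vec_nth v"]
        beta_min_Lipschitz[OF assms, of P "vec_nth v" "vec_nth w"]
      by (simp add: abs_minus_commute)
    then have "((\<lambda>w. ?g (vec_nth w) - ?g (vec_nth v)) \<longlongrightarrow> 0) (at v within S)"
      by (intro Lim_null_comparison[OF always_eventually lim] allI) (simp only: real_norm_def)
    then show "((\<lambda>w. ?g (vec_nth w)) \<longlongrightarrow> ?g (vec_nth v)) (at v within S)"
      by (rule LIM_zero_cancel)
  qed
  moreover have "closed {v :: real^'z. ?C (vec_nth v)}"
  proof -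
    have "{v :: real^'z. ?C (vec_nth v)} = cbox 0 1 \<inter> {v. inner_on UNIV ones (vec_nth v) = 1}"
      by (auto simp: tests_def mem_box_cart)
    also have "closed \<dots>"
      by (intro closed_Int closed_cbox closed_Collect_eq continuous_intros)
    finally show ?thesis .
  qed
  ultimately have "\<exists>q. ?C q \<and> (\<forall>q'. ?C q' \<longrightarrow> - ?g q \<le> - ?g q')"
    using C[of "return_pmf undefined"]
    by (intro cube_attains_inf[where ?u0.0 = "pmf (return_pmf undefined)"] continuous_on_minus)
      (auto simp: tests_def)
  then obtain q where q: "q \<in> tests UNIV" "inner_on UNIV ones q = 1" "\<And>q'. ?C q' \<Longrightarrow> ?g q' \<le> ?g q"
    by auto
  have "pmf (embed_pmf q) = q"
  proof
    fix z
    have "(\<integral>\<^sup>+ x. ennreal (q x) \<partial>count_space UNIV) = 1"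
      using q by (simp add: nn_integral_count_space_finite inner_on_def ones_def tests_def sum_ennreal)
    then show "pmf (embed_pmf q) z = q z"
      using q by (intro pmf_embed_pmf) (auto simp: tests_def)
  qed
  with q C show ?thesis by (metis (no_types, lifting))
qed

text \<open>The constant test \<alpha> is feasible. Its factor \<alpha> cancels the 1 / (\<epsilon>
  - \<eta>) of the achievability bound, which therefore stays bounded as \<eta> tends to
  \<epsilon>.\<close>

lemma beta_min_uniform_bound:
  fixes P :: "('y::finite \<times> 'z::finite) pmf" and Q :: "'z pmf"
  assumes "0 \<le> \<alpha>" "\<alpha> \<le> 1"
  shows "beta_min UNIV \<alpha> (pmf P) (tensor ones (pmf Q)) \<le> \<alpha> * CARD('y)"
proof -
  have "beta_min UNIV \<alpha> (pmf P) (tensor ones (pmf Q))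
      \<le> inner_on UNIV (\<lambda>x :: 'y \<times> 'z. \<alpha> * ones x) (tensor ones (pmf Q))"
  proof (rule beta_min_le)
    show "(\<lambda>x :: 'y \<times> 'z. \<alpha> * ones x) \<in> tests UNIV" using assms by (simp add: tests_def ones_def)
    show "\<alpha> \<le> inner_on UNIV (\<lambda>x. \<alpha> * ones x) (pmf P)"
      unfolding inner_on_scale inner_on_ones by simp
  qed (rule assms)
  also have "\<dots> = \<alpha> * CARD('y)"
    unfolding inner_on_scale
    by (simp add: inner_on_def sum_UNIV_prod tensor_def ones_def sum_pmf_eq_1)
  finally show ?thesis .
qed

text \<open>The distance below the upper bound \<open>b\<close> is a natural number, so a least
  distance exists.\<close>

lemma Greatest_int:
  fixes R :: "int \<Rightarrow> bool"
  assumes "R k" "\<And>m. R m \<Longrightarrow> m \<le> b"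
  shows "R (GREATEST m. R m)"
proof -
  define n where "n = (LEAST n. R (b - int n))"
  have "R (b - int (nat (b - k)))" using assms by simp
  then have n: "R (b - int n)" unfolding n_def by (rule LeastI)
  have "m \<le> b - int n" if "R m" for m
  proof -
    have "n \<le> nat (b - m)" unfolding n_def using that assms by (intro Least_le) simp
    then show ?thesis using assms(2)[OF that] by simp
  qed
  with n have "(GREATEST m. R m) = b - int n" by (intro Greatest_equality)
  with n show ?thesis by simp
qed

theorem theorem1:
  fixes P :: "('y::finite \<times> 'z::finite) pmf"
  shows
    "(\<forall>\<epsilon>::real. 0 \<le> \<epsilon> \<and> \<epsilon> < 1 \<longrightarrow>
        real (max_key_size \<epsilon> P) \<le>
          (LEAST r. \<exists>\<eta>\<in>{0<..1 - \<epsilon>}.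
             r = 1 / \<eta> * beta_min UNIV (\<epsilon> + \<eta>) (pmf P) (tensor ones (pmf (map_pmf snd P)))))
     \<and>
     (\<forall>\<epsilon>::real. 0 < \<epsilon> \<and> \<epsilon> < 1 \<longrightarrow>
        int (max_key_size \<epsilon> P) \<ge>
          (GREATEST m::int. \<exists>\<eta>\<in>{0..<\<epsilon>}.
             m = \<lfloor>4 * \<eta>\<^sup>2 / (\<epsilon> - \<eta>) *
                   (GREATEST b. \<exists>Q :: 'z pmf.
                      b = beta_min UNIV (\<epsilon> - \<eta>) (pmf P) (tensor ones (pmf Q)))\<rfloor>))"
proof (intro conjI allI impI)
  fix \<epsilon> :: real
  assume \<epsilon>: "0 \<le> \<epsilon> \<and> \<epsilon> < 1"
  let ?Q = "tensor ones (pmf (map_pmf snd P)) :: 'y \<times> 'z \<Rightarrow> real"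
  have Q: "0 \<le> ?Q x" for x by (cases x) (simp add: tensor_def ones_def)
  have "0 < ?Q x" if "0 < pmf P x" for x
    using that unfolding pmf_positive_iff
    by (cases x) (force simp: tensor_def ones_def intro!: pmf_positive)
  then obtain \<eta> where \<eta>: "\<eta> \<in> {0<..1-\<epsilon>}" and min: "\<And>\<eta>'. \<eta>' \<in> {0<..1-\<epsilon>} \<Longrightarrow>
    1 / \<eta> * beta_min UNIV (\<epsilon> + \<eta>) (pmf P) ?Q \<le> 1 / \<eta>' * beta_min UNIV (\<epsilon> + \<eta>') (pmf P) ?Q"
    using beta_ratio_attains_min[of ?Q P \<epsilon>] Q \<epsilon> by blast
  have least: "(LEAST r. \<exists>\<eta>\<in>{0<..1 - \<epsilon>}. r = 1 / \<eta> * beta_min UNIV (\<epsilon> + \<eta>) (pmf P) ?Q)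
      = 1 / \<eta> * beta_min UNIV (\<epsilon> + \<eta>) (pmf P) ?Q"
    using \<eta> min by (intro Least_equality) auto
  obtain f where f: "privacy_amplification P (max_key_size \<epsilon> P) \<epsilon> f"
    using max_key_size_attained \<epsilon> by blast
  have "\<epsilon> + \<eta> \<le> 1" using \<eta> by simp
  then obtain \<Lambda> where L: "\<Lambda> \<in> tests UNIV" "\<epsilon> + \<eta> \<le> inner_on UNIV \<Lambda> (pmf P)"
    "beta_min UNIV (\<epsilon> + \<eta>) (pmf P) ?Q = inner_on UNIV \<Lambda> ?Q"
    using beta_min_attained[of "\<epsilon> + \<eta>" P ?Q] by metis
  have "\<eta> * max_key_size \<epsilon> P \<le> beta_min UNIV (\<epsilon> + \<eta>) (pmf P) ?Q"
    using privacy_amplification_bound[OF f L(1,2)] L(3) by simp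
  then show "real (max_key_size \<epsilon> P) \<le>
      (LEAST r. \<exists>\<eta>\<in>{0<..1 - \<epsilon>}. r = 1 / \<eta> * beta_min UNIV (\<epsilon> + \<eta>) (pmf P) ?Q)"
    unfolding least using \<eta> by (simp add: field_simps)
next
  fix \<epsilon> :: real
  assume \<epsilon>: "0 < \<epsilon> \<and> \<epsilon> < 1"
  let ?b = "\<lambda>\<eta>. GREATEST b. \<exists>Q :: 'z pmf. b = beta_min UNIV (\<epsilon> - \<eta>) (pmf P) (tensor ones (pmf Q))"
  let ?R = "\<lambda>m. \<exists>\<eta>\<in>{0..<\<epsilon>}. m = \<lfloor>4 * \<eta>\<^sup>2 / (\<epsilon> - \<eta>) * ?b \<eta>\<rfloor>"
  have b: "\<exists>Q :: 'z pmf. ?b \<eta> = beta_min UNIV (\<epsilon> - \<eta>) (pmf P) (tensor ones (pmf Q))"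
    if "0 \<le> \<eta>" for \<eta>
  proof -
    have "\<epsilon> - \<eta> \<le> 1" using \<epsilon> that by simp
    then obtain Q :: "'z pmf" where "\<And>Q' :: 'z pmf. beta_min UNIV (\<epsilon> - \<eta>) (pmf P) (tensor ones (pmf Q'))
        \<le> beta_min UNIV (\<epsilon> - \<eta>) (pmf P) (tensor ones (pmf Q))"
      using beta_min_attains_max[of "\<epsilon> - \<eta>" P] by blast
    then have "?b \<eta> = beta_min UNIV (\<epsilon> - \<eta>) (pmf P) (tensor ones (pmf Q))"
      by (intro Greatest_equality) auto
    then show ?thesis by blast
  qed
  have "m \<le> 4 * CARD('y)" if "?R m" for m
  proof -
    from that obtain \<eta> where \<eta>: "\<eta> \<in> {0..<\<epsilon>}" "m = \<lfloor>4 * \<eta>\<^sup>2 / (\<epsilon> - \<eta>) * ?b \<eta>\<rfloor>" by blast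
    have "?b \<eta> \<le> (\<epsilon> - \<eta>) * CARD('y)"
      using b[of \<eta>] beta_min_uniform_bound[of "\<epsilon> - \<eta>" P] \<eta> \<epsilon> by auto
    then have "4 * \<eta>\<^sup>2 / (\<epsilon> - \<eta>) * ?b \<eta> \<le> 4 * \<eta>\<^sup>2 / (\<epsilon> - \<eta>) * ((\<epsilon> - \<eta>) * CARD('y))"
      using \<eta> by (intro mult_left_mono) auto
    also have "\<dots> = 4 * \<eta>\<^sup>2 * CARD('y)" using \<eta> by simp
    also have "\<dots> \<le> 4 * 1 * real CARD('y)"
      using \<eta> \<epsilon> by (intro mult_right_mono mult_left_mono power_le_one) auto
    finally show ?thesis using \<eta>(2) by linarith
  qed
  \<comment> \<open>The floor makes the values integers, so boundedness and the witness \<eta> = 0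
    give a maximum on the half-open interval without continuity in \<eta>.\<close>
  then have "?R (GREATEST m. ?R m)"
    using \<epsilon> by (intro Greatest_int[of ?R "\<lfloor>4 * 0\<^sup>2 / (\<epsilon> - 0) * ?b 0\<rfloor>"] bexI[of _ 0]) auto
  then obtain \<eta> where \<eta>: "\<eta> \<in> {0..<\<epsilon>}" "(GREATEST m. ?R m) = \<lfloor>4 * \<eta>\<^sup>2 / (\<epsilon> - \<eta>) * ?b \<eta>\<rfloor>" by blast
  obtain Q :: "'z pmf" where Q: "?b \<eta> = beta_min UNIV (\<epsilon> - \<eta>) (pmf P) (tensor ones (pmf Q))"
    using b[of \<eta>] \<eta> by auto
  \<comment> \<open>A maximum that is not positive becomes K = 0, where the claim is trivial; the
    hashing lemma needs K > 0.\<close>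
  define K where "K = nat (GREATEST m. ?R m)"
  show "(GREATEST m. ?R m) \<le> int (max_key_size \<epsilon> P)"
  proof (cases "K = 0")
    case False
    then have "K \<le> 4 * \<eta>\<^sup>2 / (\<epsilon> - \<eta>) * ?b \<eta>" unfolding K_def \<eta>(2) by linarith
    then have "\<exists>f. privacy_amplification P K (\<epsilon> - \<eta> + \<eta>) f"
      using False \<eta> \<epsilon> unfolding Q by (intro privacy_amplification_exists) auto
    then have "K \<le> max_key_size \<epsilon> P" using le_max_key_size[of \<epsilon> P K] \<epsilon> by auto
    then show ?thesis by (simp add: K_def)
  qed (simp add: K_def)
qed

end
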